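(* Let $F(w)=\mathbb{E}[f(w;\xi)]$, $w\in\mathbb{R}^d$. Assume: (1) $F$ is $\mu$-strongly convex for some $\mu>0$; (2) for every realization of $\xi$, $f(\cdot;\xi)$ is $L$-smooth, with a common constant $L>0$; (3) for every realization of $\xi$, $f(\cdot;\xi)$ is convex. Let $w_*$ be the unique minimizer of $F$ and let $N=2\,\mathbb{E}[\|\nabla f(w_*;\xi)\|^2]$, assumed to satisfy $0<N<\infty$. Let $\alpha=2$ and $E=\frac{2\alpha L}{\mu}$. Consider the SGD iteration $w_{t+1}=w_t-\eta_t\nabla f(w_t;\xi_t)$, $t\ge0$, started from a given $w_0\in\mathbb{R}^d$, with step sizes $\eta_t=\frac{\alpha}{\mu(t+E)}$ (so that $\eta_t\le\eta_0=\frac{1}{2L}$). Then $$\mathbb{E}[\|w_t-w_*\|^2]\le\frac{4\alpha^2N}{\mu^2}\,\frac{1}{t-T+E}$$ for every iteration index $$t\ge T=\frac{4L}{\mu}\max\Big\{\frac{L\mu}{N}\|w_0-w_*\|^2,\,1\Big\}-\frac{4L}{\mu}.$$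
   Context: $\xi$ is a random variable with some distribution, and $f(\cdot;\xi):\mathbb{R}^d\to\mathbb{R}$ is differentiable for each realization of $\xi$. The stochastic gradient is unbiased: $\mathbb{E}[\nabla f(w;\xi)]=\nabla F(w)$ for every fixed $w$. The variables $\xi_0,\xi_1,\dots$ are i.i.d. copies of $\xi$. $\|\cdot\|$ is the Euclidean norm. $\mu$-strongly convex: $F(w)-F(w')\ge\langle\nabla F(w'),w-w'\rangle+\frac{\mu}{2}\|w-w'\|^2$ for all $w,w'\in\mathbb{R}^d$. $L$-smooth: $\|\nabla f(w;\xi)-\nabla f(w';\xi)\|\le L\|w-w'\|$ for all $w,w'\in\mathbb{R}^d$. Convex: $f(w;\xi)-f(w';\xi)\ge\langle\nabla f(w';\xi),w-w'\rangle$ for all $w,w'\in\mathbb{R}^d$. *)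

theory Defs
  imports "HOL-Analysis.Analysis" "HOL-Probability.Probability"
begin

(* The definite description is meaningful only where h is differentiable; see gderiv_grad. *)
definition grad :: "('a::euclidean_space \<Rightarrow> real) \<Rightarrow> 'a \<Rightarrow> 'a" where
  "grad h w = (THE D. GDERIV h w :> D)"

lemma grad_eqI:
  assumes "GDERIV h w :> D"
  shows "grad h w = D"
  unfolding grad_def
proof (rule the_equality)
  fix D' assume "GDERIV h w :> D'"
  with assms have "(\<lambda>v. v \<bullet> D') = (\<lambda>v. v \<bullet> D)"
    unfolding gderiv_def by (rule has_derivative_unique[rotated])
  then show "D' = D"
    by (metis inner_commute vector_eq_rdot)
qed (fact assms)

lemma gderiv_grad:
  assumes "h differentiable (at w)"
  shows "GDERIV h w :> grad h w"
proof -
  obtain h' where h': "(h has_derivative h') (at w)"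
    using assms unfolding differentiable_def by blast
  interpret bounded_linear h'
    using h' by (rule has_derivative_bounded_linear)
  have "h' v = v \<bullet> (\<Sum>b\<in>Basis. h' b *\<^sub>R b)" for v
  proof -
    have "h' v = h' (\<Sum>b\<in>Basis. (v \<bullet> b) *\<^sub>R b)"
      by (simp add: euclidean_representation)
    also have "\<dots> = v \<bullet> (\<Sum>b\<in>Basis. h' b *\<^sub>R b)"
      by (simp add: sum scaleR inner_sum_right mult.commute)
    finally show ?thesis .
  qed
  then have "h' = (\<lambda>v. v \<bullet> (\<Sum>b\<in>Basis. h' b *\<^sub>R b))"
    by blast
  then have "GDERIV h w :> (\<Sum>b\<in>Basis. h' b *\<^sub>R b)"
    using h' unfolding gderiv_def by metis
  then show ?thesis
    using grad_eqI by metis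
qed

(* The three predicates below presuppose differentiability, which is required separately. *)
definition strongly_convex :: "real \<Rightarrow> ('a::euclidean_space \<Rightarrow> real) \<Rightarrow> bool" where
  "strongly_convex \<mu> h \<longleftrightarrow>
     (\<forall>w w'. h w - h w' \<ge> grad h w' \<bullet> (w - w') + \<mu> / 2 * (norm (w - w'))\<^sup>2)"

definition smooth :: "real \<Rightarrow> ('a::euclidean_space \<Rightarrow> real) \<Rightarrow> bool" where
  "smooth L h \<longleftrightarrow> (\<forall>w w'. norm (grad h w - grad h w') \<le> L * norm (w - w'))"

definition first_order_convex :: "('a::euclidean_space \<Rightarrow> real) \<Rightarrow> bool" where
  "first_order_convex h \<longleftrightarrow> (\<forall>w w'. h w - h w' \<ge> grad h w' \<bullet> (w - w'))"

(* SGD along one sample sequence x, with step sizes \<eta>. *)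
primrec sgd :: "('a::euclidean_space \<Rightarrow> 'x \<Rightarrow> real) \<Rightarrow> (nat \<Rightarrow> real) \<Rightarrow> 'a \<Rightarrow> (nat \<Rightarrow> 'x) \<Rightarrow> nat \<Rightarrow> 'a" where
  "sgd f \<eta> w0 x 0 = w0"
| "sgd f \<eta> w0 x (Suc t) =
     sgd f \<eta> w0 x t - \<eta> t *\<^sub>R grad (\<lambda>w. f w (x t)) (sgd f \<eta> w0 x t)"

end

theory Submission
  imports Defs
begin

text \<open>
  Tilting a convex \<open>L\<close>-smooth function by its gradient at \<open>w\<^sub>*\<close> gives
  \<open>\<parallel>\<nabla>f(w;x) - \<nabla>f(w\<^sub>*;x)\<parallel>\<^sup>2 \<le> 2L (f(w;x) - f(w\<^sub>*;x) - \<langle>\<nabla>f(w\<^sub>*;x), w - w\<^sub>*\<rangle>)\<close>, so that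
  \<open>\<bbbE>\<parallel>\<nabla>f(w;\<xi>)\<parallel>\<^sup>2 \<le> 4L (F(w) - F(w\<^sub>*)) + N\<close>. Since \<open>\<eta>\<^sub>t \<le> 1/(2L)\<close>, strong convexity absorbs the first term,
  and independence of \<open>w\<^sub>t\<close> and \<open>\<xi>\<^sub>t\<close> yields \<open>a\<^sub>t\<^sub>+\<^sub>1 \<le> (1 - \<mu> \<eta>\<^sub>t) a\<^sub>t + \<eta>\<^sub>t\<^sup>2 N\<close> for
  \<open>a\<^sub>t = \<bbbE>\<parallel>w\<^sub>t - w\<^sub>*\<parallel>\<^sup>2\<close>. With \<open>s = t + E\<close> and \<open>C = 4N/\<mu>\<^sup>2\<close>, multiplying by \<open>s (s - 1)\<close> makes the
  recursion telescope: \<open>(s - 1)(s - 2) a\<^sub>t \<le> (E - 1)(E - 2) a\<^sub>0 + C t \<le> C (s + T)\<close>, and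
  \<open>(s + T)(s - T) \<le> 4 (s - 1)(s - 2)\<close> because \<open>s \<ge> E \<ge> 4\<close>, which is \<open>\<mu> \<le> L\<close>.
\<close>

section \<open>Gradient inequalities for a single differentiable function\<close>

lemma grad_line_derivative:
  assumes "h differentiable (at (x + s *\<^sub>R d))"
  shows "((\<lambda>s. h (x + s *\<^sub>R d)) has_real_derivative grad h (x + s *\<^sub>R d) \<bullet> d) (at s)"
proof -
  have "(h has_derivative (\<lambda>v. v \<bullet> grad h (x + s *\<^sub>R d))) (at (x + s *\<^sub>R d))"
    using gderiv_grad[OF assms] by (simp add: gderiv_def)
  moreover have "((\<lambda>s. x + s *\<^sub>R d) has_derivative (\<lambda>r. r *\<^sub>R d)) (at s)"
    by (auto intro!: derivative_eq_intros)
  ultimately have "((\<lambda>s. h (x + s *\<^sub>R d)) has_derivative (\<lambda>r. (r *\<^sub>R d) \<bullet> grad h (x + s *\<^sub>R d))) (at s)"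
    by (rule has_derivative_compose[rotated])
  then show ?thesis
    by (simp add: has_field_derivative_def inner_commute mult_commute_abs)
qed

text \<open>Along the segment from \<open>x\<close> to \<open>x + d\<close>, let
  \<open>\<phi>\<close> be \<open>h\<close> minus the claimed linear and quadratic terms. By
  Cauchy-Schwarz and the Lipschitz gradient its derivative is nonpositive, so the bound follows
  without integrating the gradient.\<close>

lemma smooth_quadratic_upper_bound:
  assumes diff: "\<And>w. h differentiable (at w)" and "smooth L h"
  shows "h (x + d) \<le> h x + grad h x \<bullet> d + L / 2 * (norm d)\<^sup>2"
proof -
  define \<phi> where "\<phi> s = h (x + s *\<^sub>R d) - s * (grad h x \<bullet> d) - L / 2 * s\<^sup>2 * (norm d)\<^sup>2" for s :: real
  have "\<phi> 1 \<le> \<phi> 0"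
  proof (rule DERIV_nonpos_imp_nonincreasing[where f = \<phi>])
    fix s :: real assume s: "0 \<le> s" "s \<le> 1"
    have "(\<phi> has_real_derivative (grad h (x + s *\<^sub>R d) \<bullet> d - grad h x \<bullet> d - L * s * (norm d)\<^sup>2)) (at s)"
      unfolding \<phi>_def by (auto intro!: derivative_eq_intros grad_line_derivative[OF diff])
    moreover have "grad h (x + s *\<^sub>R d) \<bullet> d - grad h x \<bullet> d - L * s * (norm d)\<^sup>2 \<le> 0"
    proof -
      have "(grad h (x + s *\<^sub>R d) - grad h x) \<bullet> d \<le> norm (grad h (x + s *\<^sub>R d) - grad h x) * norm d"
        by (rule norm_cauchy_schwarz)
      also have "norm (grad h (x + s *\<^sub>R d) - grad h x) * norm d
          \<le> (L * norm (x + s *\<^sub>R d - x)) * norm d"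
        using assms(2)[unfolded smooth_def, rule_format] by (rule mult_right_mono) simp
      also have "\<dots> = L * s * (norm d)\<^sup>2"
        using s by (simp add: power2_eq_square)
      finally show ?thesis
        by (simp add: inner_diff_left)
    qed
    ultimately show "\<exists>y. (\<phi> has_real_derivative y) (at s) \<and> y \<le> 0" by blast
  qed simp
  then show ?thesis by (simp add: \<phi>_def)
qed

text \<open>Compare the minimum at \<open>w'\<close> of the tilted function \<open>h - grad h w' \<bullet> _\<close> with its
  value after one gradient step of length \<open>1 / L\<close> from \<open>w\<close>.\<close>
lemma smooth_convex_grad_diff_bound:
  assumes diff: "\<And>w. h differentiable (at w)" and sm: "smooth L h"
    and conv: "first_order_convex h" and "L > 0"
  shows "(norm (grad h w - grad h w'))\<^sup>2 \<le> 2 * L * (h w - h w' - grad h w' \<bullet> (w - w'))"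
proof -
  define g where "g = grad h w - grad h w'"
  define d where "d = - (1 / L) *\<^sub>R g"
  have "h (w + d) \<le> h w + grad h w \<bullet> d + L / 2 * (norm d)\<^sup>2"
    by (rule smooth_quadratic_upper_bound[OF diff sm])
  moreover have "h (w + d) - h w' \<ge> grad h w' \<bullet> (w + d - w')"
    using conv unfolding first_order_convex_def by blast
  moreover have "grad h w' \<bullet> (w + d - w') = grad h w' \<bullet> (w - w') + grad h w' \<bullet> d"
    by (simp add: algebra_simps inner_add_right inner_diff_right)
  moreover have "grad h w \<bullet> d - grad h w' \<bullet> d = - (norm g)\<^sup>2 / L"
  proof -
    have "grad h w \<bullet> d - grad h w' \<bullet> d = g \<bullet> d"
      by (simp add: g_def inner_diff_left)
    then show ?thesis
      by (simp add: d_def power2_norm_eq_inner)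
  qed
  moreover have "L / 2 * (norm d)\<^sup>2 = (norm g)\<^sup>2 / (2 * L)"
    using \<open>L > 0\<close> by (simp add: d_def power_divide power2_eq_square)
  moreover have "(norm g)\<^sup>2 / (2 * L) = (norm g)\<^sup>2 / L - (norm g)\<^sup>2 / (2 * L)"
    by (simp add: field_simps)
  ultimately have "(norm g)\<^sup>2 / (2 * L) \<le> h w - h w' - grad h w' \<bullet> (w - w')"
    by linarith
  then show ?thesis
    using \<open>L > 0\<close> by (simp add: g_def pos_divide_le_eq mult.commute)
qed

lemma grad_eq_0_at_minimum:
  assumes "h differentiable (at w)" and "\<And>v. h w \<le> h v"
  shows "grad h w = 0"
proof -
  have "(h has_derivative (\<lambda>v. v \<bullet> grad h w)) (at w)"
    using gderiv_grad[OF assms(1)] by (simp add: gderiv_def)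
  then have "(\<lambda>v. v \<bullet> grad h w) = (\<lambda>v. 0)"
    by (rule differential_zero_maxmin[of w UNIV, rotated 2]) (use assms(2) in auto)
  then show ?thesis
    by (metis inner_eq_zero_iff)
qed

section \<open>Measurability of gradients at random points\<close>

lemma borel_measurable_caratheodory:
  fixes h :: "'b::{second_countable_topology,metric_space} \<Rightarrow> 'a \<Rightarrow> 'c::metric_space"
  assumes h: "\<And>w. h w \<in> borel_measurable M"
    and cont: "\<And>x. x \<in> space M \<Longrightarrow> continuous_on UNIV (\<lambda>w. h w x)"
    and g: "g \<in> borel_measurable M"
  shows "(\<lambda>x. h (g x) x) \<in> borel_measurable M"
proof -
  \<comment> \<open>Replacing \<open>g\<close> by simple functions leaves finitely many first
    arguments for \<open>h\<close>, so measurability of each \<open>h w\<close> suffices; continuity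
    in \<open>w\<close> then passes to the limit. \<open>undefined\<close> is just a centre for the
    distance bound that accompanies the approximation.\<close>
  obtain G where G: "\<And>i. simple_function M (G i)" "\<And>x. x \<in> space M \<Longrightarrow> (\<lambda>i. G i x) \<longlonglongrightarrow> g x"
    using borel_measurable_implies_sequence_metric[OF g, of undefined] by metis
  show ?thesis
  proof (rule borel_measurable_LIMSEQ_metric)
    fix i
    show "(\<lambda>x. h (G i x) x) \<in> borel_measurable M"
    proof (rule measurable_compose_countable'[where f = h and g = "G i"])
      show "G i \<in> measurable M (count_space (G i ` space M))"
        using simple_functionD[OF G(1)[of i]] by (simp add: measurable_count_space_eq2)
      show "countable (G i ` space M)"
        using G(1)[of i] by (auto simp: simple_function_def intro: countable_finite)
    qed (rule h)
  next
    fix x assume x: "x \<in> space M"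
    show "(\<lambda>i. h (G i x) x) \<longlonglongrightarrow> h (g x) x"
      using G(2)[OF x] by (auto intro: continuous_on_tendsto_compose[OF cont[OF x]])
  qed
qed

text \<open>\<open>grad\<close> is a definite description, so measurability is obtained from its
  coordinates, which are limits of difference quotients of \<open>f\<close> along the steps
  \<open>1 / (n + 1)\<close>.\<close>

lemma borel_measurable_grad:
  fixes f :: "'b::euclidean_space \<Rightarrow> 'a \<Rightarrow> real"
  assumes f: "\<And>w. f w \<in> borel_measurable M"
    and diff: "\<And>x. x \<in> space M \<Longrightarrow> (\<lambda>v. f v x) differentiable (at w)"
  shows "(\<lambda>x. grad (\<lambda>v. f v x) w) \<in> borel_measurable M"
proof (rule borel_measurable_euclidean_space[THEN iffD2], intro ballI)
  fix b :: 'b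
  have null: "(\<lambda>n. inverse (real (Suc n))) \<longlonglongrightarrow> 0"
    by (rule LIMSEQ_inverse_real_of_nat)
  show "(\<lambda>x. grad (\<lambda>v. f v x) w \<bullet> b) \<in> borel_measurable M"
  proof (rule borel_measurable_LIMSEQ_real)
    fix x assume "x \<in> space M"
    then have "((\<lambda>s. f (w + s *\<^sub>R b) x) has_real_derivative grad (\<lambda>v. f v x) w \<bullet> b) (at 0)"
      using grad_line_derivative[of "\<lambda>v. f v x" w 0 b] diff by simp
    then have "((\<lambda>s. (f (w + s *\<^sub>R b) x - f w x) / s) \<longlongrightarrow> grad (\<lambda>v. f v x) w \<bullet> b) (at 0)"
      by (simp add: DERIV_def)
    then show "(\<lambda>n. (f (w + inverse (real (Suc n)) *\<^sub>R b) x - f w x) / inverse (real (Suc n)))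
        \<longlonglongrightarrow> grad (\<lambda>v. f v x) w \<bullet> b"
      by (rule filterlim_compose) (use null in \<open>auto simp: filterlim_at\<close>)
  qed (use f in measurable)
qed

section \<open>Estimates for one stochastic gradient step from a fixed point\<close>

locale stochastic_gradient_problem = prob_space P for P :: "'x measure" +
  fixes f :: "'a::euclidean_space \<Rightarrow> 'x \<Rightarrow> real" and F :: "'a \<Rightarrow> real"
    and \<mu> L :: real and wstar :: 'a
  assumes measurable_f: "\<And>w. f w \<in> borel_measurable P"
    and integrable_f: "\<And>w. integrable P (f w)"
    and F_eq: "\<And>w. F w = (\<integral>x. f w x \<partial>P)"
    and f_differentiable: "\<And>x w. x \<in> space P \<Longrightarrow> (\<lambda>v. f v x) differentiable (at w)"
    and F_differentiable: "\<And>w. F differentiable (at w)"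
    and grad_unbiased: "\<And>w. has_bochner_integral P (\<lambda>x. grad (\<lambda>v. f v x) w) (grad F w)"
    and mu_pos: "\<mu> > 0" and F_strongly_convex: "strongly_convex \<mu> F"
    and L_pos: "L > 0" and f_smooth: "\<And>x. x \<in> space P \<Longrightarrow> smooth L (\<lambda>w. f w x)"
    and f_convex: "\<And>x. x \<in> space P \<Longrightarrow> first_order_convex (\<lambda>w. f w x)"
    and wstar_minimum: "\<And>w. F wstar \<le> F w"
    and noise_integrable: "integrable P (\<lambda>x. (norm (grad (\<lambda>w. f w x) wstar))\<^sup>2)"
begin

abbreviation G :: "'a \<Rightarrow> 'x \<Rightarrow> 'a" where
  "G w x \<equiv> grad (\<lambda>v. f v x) w"

definition noise :: real where
  "noise = 2 * (\<integral>x. (norm (G wstar x))\<^sup>2 \<partial>P)"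

lemma noise_nonneg: "noise \<ge> 0"
  by (simp add: noise_def)

lemma grad_F_wstar: "grad F wstar = 0"
  using grad_eq_0_at_minimum[OF F_differentiable] wstar_minimum by blast

lemma integrable_G: "integrable P (G w)" and integral_G: "(\<integral>x. G w x \<partial>P) = grad F w"
  using grad_unbiased[of w] by (auto simp: has_bochner_integral_iff)

lemma measurable_G: "G w \<in> borel_measurable P"
  using integrable_G by (rule borel_measurable_integrable)

lemma G_Lipschitz: "x \<in> space P \<Longrightarrow> norm (G w x - G w' x) \<le> L * norm (w - w')"
  using f_smooth[of x] unfolding smooth_def by blast

lemma continuous_on_G:
  assumes "x \<in> space P"
  shows "continuous_on A (\<lambda>w. G w x)"
proof -
  have "L-lipschitz_on A (\<lambda>w. G w x)"
    using G_Lipschitz[OF assms] L_pos by (intro lipschitz_onI) (auto simp: dist_norm)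
  then show ?thesis by (rule lipschitz_on_continuous_on)
qed

text \<open>Adding strong convexity at \<open>(b, 0)\<close> and \<open>(0, b)\<close> for a unit
  vector \<open>b\<close> bounds \<mu> by the monotonicity gap of \<open>grad F\<close>; averaging
  the Lipschitz bound of \<open>G\<close> over \<open>P\<close> bounds this gap by
  \<open>L\<close>.\<close>

lemma mu_le_L: "\<mu> \<le> L"
proof -
  obtain b :: 'a where b: "b \<in> Basis" using nonempty_Basis by blast
  have "F b - F 0 \<ge> grad F 0 \<bullet> b + \<mu> / 2" "F 0 - F b \<ge> - (grad F b \<bullet> b) + \<mu> / 2"
    using F_strongly_convex[unfolded strongly_convex_def, rule_format, of 0 b]
      F_strongly_convex[unfolded strongly_convex_def, rule_format, of b 0] b by auto
  then have "\<mu> \<le> (grad F b - grad F 0) \<bullet> b"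
    by (simp add: inner_diff_left)
  also have "\<dots> \<le> norm (grad F b - grad F 0)"
    using norm_cauchy_schwarz[of "grad F b - grad F 0" b] b by simp
  also have "grad F b - grad F 0 = (\<integral>x. G b x - G 0 x \<partial>P)"
    using integrable_G by (simp add: integral_G)
  also have "norm \<dots> \<le> (\<integral>x. norm (G b x - G 0 x) \<partial>P)"
    by (rule integral_norm_bound)
  also have "\<dots> \<le> (\<integral>x. L \<partial>P)"
    using integrable_G G_Lipschitz[of _ b 0] b by (intro integral_mono) auto
  finally show ?thesis by (simp add: prob_space)
qed

lemma
  shows integrable_norm_G_sq: "integrable P (\<lambda>x. (norm (G w x))\<^sup>2)"
    and integral_norm_G_sq_le: "(\<integral>x. (norm (G w x))\<^sup>2 \<partial>P) \<le> 4 * L * (F w - F wstar) + noise"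
proof -
  define B where "B x = 4 * L * (f w x - f wstar x - G wstar x \<bullet> (w - wstar)) + 2 * (norm (G wstar x))\<^sup>2" for x
  have le: "(norm (G w x))\<^sup>2 \<le> B x" if x: "x \<in> space P" for x
  proof -
    \<comment> \<open>Parallelogram law for \<open>G w x - G wstar x\<close> and
      \<open>G wstar x\<close>: the sum of the two vectors is \<open>G w x\<close>, and the square
      of their difference is dropped.\<close>
    have "(norm (G w x))\<^sup>2 + (norm (G w x - 2 *\<^sub>R G wstar x))\<^sup>2
        = 2 * (norm (G w x - G wstar x))\<^sup>2 + 2 * (norm (G wstar x))\<^sup>2"
      by (simp add: power2_norm_eq_inner algebra_simps inner_commute)
    moreover have "(norm (G w x - G wstar x))\<^sup>2 \<le> 2 * L * (f w x - f wstar x - G wstar x \<bullet> (w - wstar))"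
      by (intro smooth_convex_grad_diff_bound f_differentiable f_smooth f_convex L_pos x)
    moreover have "0 \<le> (norm (G w x - 2 *\<^sub>R G wstar x))\<^sup>2" by simp
    ultimately show ?thesis unfolding B_def by linarith
  qed
  have B: "integrable P B"
    unfolding B_def using integrable_f integrable_G noise_integrable by auto
  show int: "integrable P (\<lambda>x. (norm (G w x))\<^sup>2)"
    by (rule Bochner_Integration.integrable_bound[OF B])
      (use le measurable_G in \<open>auto intro!: AE_I2 order.trans[OF le]\<close>)
  have "(\<integral>x. (norm (G w x))\<^sup>2 \<partial>P) \<le> (\<integral>x. B x \<partial>P)"
    by (intro integral_mono int B le)
  \<comment> \<open>The linear term of \<open>B\<close> integrates to zero because the mean of
    \<open>G wstar\<close> is \<open>grad F wstar = 0\<close>.\<close>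
  also have "\<dots> = 4 * L * (F w - F wstar) + noise"
    unfolding B_def using integrable_f integrable_G noise_integrable
    by (simp add: F_eq noise_def integral_G grad_F_wstar)
  finally show "(\<integral>x. (norm (G w x))\<^sup>2 \<partial>P) \<le> 4 * L * (F w - F wstar) + noise" .
qed

lemma
  assumes "0 \<le> c" and c: "2 * L * c \<le> 1"
  shows integrable_gradient_step: "integrable P (\<lambda>x. (norm (w - c *\<^sub>R G w x - wstar))\<^sup>2)" (is ?int)
    and integral_gradient_step_le: "(\<integral>x. (norm (w - c *\<^sub>R G w x - wstar))\<^sup>2 \<partial>P)
          \<le> (1 - \<mu> * c) * (norm (w - wstar))\<^sup>2 + c\<^sup>2 * noise" (is ?le)
proof -
  have expand: "(norm (w - c *\<^sub>R G w x - wstar))\<^sup>2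
      = (norm (w - wstar))\<^sup>2 - 2 * c * (G w x \<bullet> (w - wstar)) + c\<^sup>2 * (norm (G w x))\<^sup>2" for x
    unfolding power2_norm_eq_inner
    by (simp add: inner_diff_left inner_diff_right inner_commute power2_eq_square algebra_simps)
  show ?int
    unfolding expand using integrable_G integrable_norm_G_sq by auto
  have "F wstar - F w \<ge> grad F w \<bullet> (wstar - w) + \<mu> / 2 * (norm (wstar - w))\<^sup>2"
    using F_strongly_convex unfolding strongly_convex_def by blast
  then have "grad F w \<bullet> (w - wstar) \<ge> F w - F wstar + \<mu> / 2 * (norm (w - wstar))\<^sup>2"
    by (simp add: inner_diff_right norm_minus_commute)
  then have 1: "2 * c * (grad F w \<bullet> (w - wstar)) \<ge> 2 * c * (F w - F wstar + \<mu> / 2 * (norm (w - wstar))\<^sup>2)"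
    using assms by (intro mult_left_mono) auto
  have 2: "c\<^sup>2 * (\<integral>x. (norm (G w x))\<^sup>2 \<partial>P) \<le> c\<^sup>2 * (4 * L * (F w - F wstar) + noise)"
    by (intro mult_left_mono integral_norm_G_sq_le) auto
  \<comment> \<open>Strong convexity contributes \<open>- 2 * c\<close> times the gap
    \<open>F w - F wstar\<close>, the second moment at most \<open>4 * L * c\<^sup>2\<close> times
    it; the step size condition makes the total nonpositive.\<close>
  have 3: "2 * c * (1 - 2 * L * c) * (F w - F wstar) \<ge> 0"
    using assms wstar_minimum by simp
  have "(\<integral>x. (norm (w - c *\<^sub>R G w x - wstar))\<^sup>2 \<partial>P)
      = (norm (w - wstar))\<^sup>2 - 2 * c * (grad F w \<bullet> (w - wstar)) + c\<^sup>2 * (\<integral>x. (norm (G w x))\<^sup>2 \<partial>P)"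
    unfolding expand using integrable_G integrable_norm_G_sq by (simp add: integral_G prob_space)
  also have "\<dots> \<le> (1 - \<mu> * c) * (norm (w - wstar))\<^sup>2 + c\<^sup>2 * noise"
    using 1 2 3 by (simp add: algebra_simps power2_eq_square)
  finally show ?le .
qed

lemma borel_measurable_G_comp:
  assumes "g \<in> borel_measurable M" and X: "X \<in> measurable M P"
  shows "(\<lambda>\<omega>. G (g \<omega>) (X \<omega>)) \<in> borel_measurable M"
  by (rule borel_measurable_caratheodory[where h = "\<lambda>w \<omega>. G w (X \<omega>)"])
    (use measurable_compose[OF X measurable_G] continuous_on_G measurable_space[OF X] assms in auto)

lemma borel_measurable_sgd:
  assumes "\<And>s. s < t \<Longrightarrow> X s \<in> measurable M P"
  shows "(\<lambda>\<omega>. sgd f \<eta> w0 (\<lambda>s. X s \<omega>) t) \<in> borel_measurable M"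
  using assms
proof (induction t)
  case (Suc t)
  then have "(\<lambda>\<omega>. sgd f \<eta> w0 (\<lambda>s. X s \<omega>) t) \<in> borel_measurable M" by simp
  with borel_measurable_G_comp[OF this] Suc.prems[of t] show ?case by simp
qed simp

end

section \<open>Conditioning on the past through independence\<close>

lemma sgd_cong:
  assumes "\<And>s. s < t \<Longrightarrow> x s = y s"
  shows "sgd f \<eta> w0 x t = sgd f \<eta> w0 y t"
  using assms by (induction t) auto

text \<open>Independence makes the joint law a product, and Tonelli's theorem then splits the
  integral. Nonnegative integrals avoid any prior integrability of the next iterate.\<close>

lemma (in prob_space) nn_integral_indep_var:
  assumes ind: "indep_var A X B Y" and h: "h \<in> borel_measurable (A \<Otimes>\<^sub>M B)"
  shows "(\<integral>\<^sup>+\<omega>. h (X \<omega>, Y \<omega>) \<partial>M) = (\<integral>\<^sup>+\<omega>. (\<integral>\<^sup>+\<omega>'. h (X \<omega>, Y \<omega>') \<partial>M) \<partial>M)"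
proof -
  have X: "X \<in> measurable M A" and Y: "Y \<in> measurable M B"
    and eq: "distr M A X \<Otimes>\<^sub>M distr M B Y = distr M (A \<Otimes>\<^sub>M B) (\<lambda>\<omega>. (X \<omega>, Y \<omega>))"
    using ind unfolding indep_var_distribution_eq by auto
  interpret Y: prob_space "distr M B Y" by (rule prob_space_distr[OF Y])
  have h': "h \<in> borel_measurable (distr M A X \<Otimes>\<^sub>M distr M B Y)"
    using h by (simp cong: measurable_cong_sets sets_pair_measure_cong)
  have "(\<integral>\<^sup>+\<omega>. h (X \<omega>, Y \<omega>) \<partial>M) = (\<integral>\<^sup>+p. h p \<partial>distr M (A \<Otimes>\<^sub>M B) (\<lambda>\<omega>. (X \<omega>, Y \<omega>)))"
    using X Y h by (subst nn_integral_distr) auto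
  also have "\<dots> = (\<integral>\<^sup>+x. (\<integral>\<^sup>+y. h (x, y) \<partial>distr M B Y) \<partial>distr M A X)"
    unfolding eq[symmetric] using h' by (rule Y.nn_integral_fst[symmetric])
  also have "\<dots> = (\<integral>\<^sup>+\<omega>. (\<integral>\<^sup>+y. h (X \<omega>, y) \<partial>distr M B Y) \<partial>M)"
    using Y.borel_measurable_nn_integral_fst[OF h'] by (intro nn_integral_distr X) auto
  also have "\<dots> = (\<integral>\<^sup>+\<omega>. (\<integral>\<^sup>+\<omega>'. h (X \<omega>, Y \<omega>') \<partial>M) \<partial>M)"
    using measurable_space[OF X] h Y
    by (intro nn_integral_cong nn_integral_distr measurable_compose[OF measurable_Pair1'[of _ A B] h]) auto
  finally show ?thesis .
qed

text \<open>\<^const>\<open>prob_space.indep_var\<close> needs two variables of the same type. The iterate and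
  the sample have different types, so independence is stated between the two restricted
  families, and the map \<open>g\<close> from the past to the iterate is kept inside the integrand.\<close>
lemma (in prob_space) nn_integral_indep_past:
  fixes X :: "nat \<Rightarrow> 'a \<Rightarrow> 'b"
  assumes ind: "indep_vars (\<lambda>_. S) X UNIV"
    and g: "g \<in> measurable (PiM {..<t} (\<lambda>_. S)) B"
    and h: "h \<in> borel_measurable (B \<Otimes>\<^sub>M S)"
  shows "(\<integral>\<^sup>+\<omega>. h (g (restrict (\<lambda>i. X i \<omega>) {..<t}), X t \<omega>) \<partial>M)
    = (\<integral>\<^sup>+\<omega>. (\<integral>\<^sup>+y. h (g (restrict (\<lambda>i. X i \<omega>) {..<t}), y) \<partial>distr M S (X t)) \<partial>M)"
proof -
  define past where "past \<omega> = restrict (\<lambda>i. X i \<omega>) {..<t}" for \<omega>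
  have X: "X i \<in> measurable M S" for i
    using ind unfolding indep_vars_def by auto
  have past: "past \<in> measurable M (PiM {..<t} (\<lambda>_. S))"
    unfolding past_def using X by measurable
  have ind': "indep_var (PiM {..<t} (\<lambda>_. S)) past (PiM {t} (\<lambda>_. S)) (\<lambda>\<omega>. restrict (\<lambda>i. X i \<omega>) {t})"
    unfolding past_def by (rule indep_var_restrict[OF ind]) auto
  \<comment> \<open>The current sample is a family over the one-point index set \<open>{t}\<close>,
    disjoint from \<open>{..<t}\<close>; \<open>snd p t\<close> reads it off.\<close>
  have "(\<lambda>p. h (g (fst p), snd p t)) \<in> borel_measurable (PiM {..<t} (\<lambda>_. S) \<Otimes>\<^sub>M PiM {t} (\<lambda>_. S))"
    using g by (intro measurable_compose[OF _ h] measurable_Pair) auto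
  from nn_integral_indep_var[OF ind' this]
  have "(\<integral>\<^sup>+\<omega>. h (g (past \<omega>), X t \<omega>) \<partial>M) = (\<integral>\<^sup>+\<omega>. (\<integral>\<^sup>+\<omega>'. h (g (past \<omega>), X t \<omega>') \<partial>M) \<partial>M)"
    by simp
  also have "\<dots> = (\<integral>\<^sup>+\<omega>. (\<integral>\<^sup>+y. h (g (past \<omega>), y) \<partial>distr M S (X t)) \<partial>M)"
    using measurable_space[OF measurable_compose[OF past g]] measurable_compose[OF measurable_Pair1' h]
    by (intro nn_integral_cong nn_integral_distr[symmetric] X) simp
  finally show ?thesis by (simp add: past_def)
qed

section \<open>Recursion for the mean squared distance of the random iterates\<close>

locale sgd_process = stochastic_gradient_problem P f F \<mu> L wstar + M: prob_space M
  for P :: "'x measure" and f :: "'a::euclidean_space \<Rightarrow> 'x \<Rightarrow> real" and F \<mu> L wstar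
    and M :: "'o measure" +
  fixes \<Xi> :: "nat \<Rightarrow> 'o \<Rightarrow> 'x" and \<eta> :: "nat \<Rightarrow> real" and w0 :: 'a
  assumes indep: "M.indep_vars (\<lambda>_. P) \<Xi> UNIV"
    and distr_sample: "\<And>s. distr M P (\<Xi> s) = P"
    and eta_nonneg: "\<And>s. \<eta> s \<ge> 0" and eta_le: "\<And>s. 2 * L * \<eta> s \<le> 1"
begin

definition w :: "nat \<Rightarrow> 'o \<Rightarrow> 'a" where
  "w t \<omega> = sgd f \<eta> w0 (\<lambda>s. \<Xi> s \<omega>) t"

lemma measurable_sample: "\<Xi> s \<in> measurable M P"
  using indep unfolding M.indep_vars_def by auto

lemma measurable_w: "w t \<in> borel_measurable M"
  unfolding w_def using borel_measurable_sgd measurable_sample by blast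

lemma w_0: "w 0 \<omega> = w0"
  by (simp add: w_def)

lemma w_Suc: "w (Suc t) \<omega> = w t \<omega> - \<eta> t *\<^sub>R G (w t \<omega>) (\<Xi> t \<omega>)"
  by (simp add: w_def)

lemma nn_integral_w_Suc_le:
  "(\<integral>\<^sup>+\<omega>. ennreal ((norm (w (Suc t) \<omega> - wstar))\<^sup>2) \<partial>M)
    \<le> (\<integral>\<^sup>+\<omega>. ennreal ((1 - \<mu> * \<eta> t) * (norm (w t \<omega> - wstar))\<^sup>2 + (\<eta> t)\<^sup>2 * noise) \<partial>M)"
proof -
  define h where "h p = ennreal ((norm (fst p - \<eta> t *\<^sub>R G (fst p) (snd p) - wstar))\<^sup>2)" for p
  have h: "h \<in> borel_measurable (borel \<Otimes>\<^sub>M P)"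
    using borel_measurable_G_comp[OF measurable_fst measurable_snd] unfolding h_def by measurable
  have "(\<integral>\<^sup>+\<omega>. ennreal ((norm (w (Suc t) \<omega> - wstar))\<^sup>2) \<partial>M) = (\<integral>\<^sup>+\<omega>. h (w t \<omega>, \<Xi> t \<omega>) \<partial>M)"
    by (simp add: w_Suc h_def)
  also have "\<dots> = (\<integral>\<^sup>+\<omega>. (\<integral>\<^sup>+x. h (w t \<omega>, x) \<partial>P) \<partial>M)"
  proof -
    have past: "(\<lambda>x. sgd f \<eta> w0 x t) \<in> borel_measurable (PiM {..<t} (\<lambda>_. P))"
      by (rule borel_measurable_sgd[where X = "\<lambda>s x. x s"]) simp
    \<comment> \<open>The iterate with index \<open>t\<close> uses only samples strictly before
      \<open>t\<close>, so it is a function of the restricted past and the sample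
      \<open>\<Xi> t\<close> is fresh.\<close>
    have "w t \<omega> = sgd f \<eta> w0 (restrict (\<lambda>i. \<Xi> i \<omega>) {..<t}) t" for \<omega>
      unfolding w_def by (rule sgd_cong) simp
    then show ?thesis
      using M.nn_integral_indep_past[OF indep past h] by (simp add: distr_sample)
  qed
  also have "\<dots> \<le> (\<integral>\<^sup>+\<omega>. ennreal ((1 - \<mu> * \<eta> t) * (norm (w t \<omega> - wstar))\<^sup>2 + (\<eta> t)\<^sup>2 * noise) \<partial>M)"
    unfolding h_def fst_conv snd_conv
    by (intro nn_integral_mono, subst nn_integral_eq_integral)
      (auto intro!: integrable_gradient_step integral_gradient_step_le ennreal_leI eta_nonneg eta_le)
  finally show ?thesis .
qed

text \<open>\<open>ennreal\<close> sends negative numbers to zero, so a nonnegative factor is what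
  lets the bound return from nonnegative to Bochner integrals.\<close>

lemma contraction_nonneg: "0 \<le> 1 - \<mu> * \<eta> t"
proof -
  have "\<mu> * \<eta> t \<le> L * \<eta> t" using mu_le_L eta_nonneg by (intro mult_right_mono) auto
  moreover have "0 \<le> L * \<eta> t" using L_pos eta_nonneg[of t] by simp
  ultimately show ?thesis using eta_le[of t] by linarith
qed

text \<open>By induction, the one-step bound in nonnegative integrals is finite once the previous
  squared distance is integrable.\<close>

lemma integrable_w: "integrable M (\<lambda>\<omega>. (norm (w t \<omega> - wstar))\<^sup>2)"
proof (induction t)
  case 0
  show ?case by (simp add: w_0)
next
  case (Suc t)
  have "(\<integral>\<^sup>+\<omega>. ennreal ((1 - \<mu> * \<eta> t) * (norm (w t \<omega> - wstar))\<^sup>2 + (\<eta> t)\<^sup>2 * noise) \<partial>M) < \<infinity>"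
    using Suc contraction_nonneg[of t] noise_nonneg by (subst nn_integral_eq_integral) auto
  then show ?case
    using measurable_w[of "Suc t"] nn_integral_w_Suc_le[of t]
    by (intro integrableI_nonneg) (auto intro: le_less_trans)
qed

lemma integral_w_Suc_le:
  "(\<integral>\<omega>. (norm (w (Suc t) \<omega> - wstar))\<^sup>2 \<partial>M)
    \<le> (1 - \<mu> * \<eta> t) * (\<integral>\<omega>. (norm (w t \<omega> - wstar))\<^sup>2 \<partial>M) + (\<eta> t)\<^sup>2 * noise"
proof -
  have nonneg: "0 \<le> (1 - \<mu> * \<eta> t) * r\<^sup>2 + (\<eta> t)\<^sup>2 * noise" for r
    using contraction_nonneg noise_nonneg by simp
  have "ennreal (\<integral>\<omega>. (norm (w (Suc t) \<omega> - wstar))\<^sup>2 \<partial>M)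
      \<le> ennreal (\<integral>\<omega>. (1 - \<mu> * \<eta> t) * (norm (w t \<omega> - wstar))\<^sup>2 + (\<eta> t)\<^sup>2 * noise \<partial>M)"
    using nn_integral_w_Suc_le[of t] integrable_w[of t] integrable_w[of "Suc t"] nonneg
    by (simp add: nn_integral_eq_integral)
  then have "(\<integral>\<omega>. (norm (w (Suc t) \<omega> - wstar))\<^sup>2 \<partial>M)
      \<le> (\<integral>\<omega>. (1 - \<mu> * \<eta> t) * (norm (w t \<omega> - wstar))\<^sup>2 + (\<eta> t)\<^sup>2 * noise \<partial>M)"
    using nonneg by (subst (asm) ennreal_le_iff) (auto intro!: integral_nonneg)
  then show ?thesis
    using integrable_w[of t] by (simp add: M.prob_space)
qed

end

section \<open>Solving the scalar recursion\<close>

lemma shifted_recursion_bound: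
  fixes a :: "nat \<Rightarrow> real"
  assumes "E \<ge> 4" "C \<ge> 0"
    and step: "\<And>t. a (Suc t) \<le> (1 - 2 / (real t + E)) * a t + C / (real t + E)\<^sup>2"
  shows "(real t + E - 1) * (real t + E - 2) * a t \<le> (E - 1) * (E - 2) * a 0 + C * real t"
proof (induction t)
  case (Suc t)
  define s where "s = real t + E"
  have s: "s \<ge> 4" using assms by (simp add: s_def)
  \<comment> \<open>The weight \<open>(s - 1) * (s - 2)\<close> at index \<open>t\<close> becomes
    \<open>s * (s - 1)\<close> at \<open>Suc t\<close>. The factor \<open>1 - 2 / s\<close> turns
    the latter back into the former, and each step adds at most \<open>C\<close>.\<close>
  have "s * (s - 1) * a (Suc t) \<le> s * (s - 1) * ((1 - 2 / s) * a t + C / s\<^sup>2)"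
    using step[of t] s unfolding s_def by (intro mult_left_mono) auto
  also have "\<dots> = (s - 1) * (s - 2) * a t + C * ((s - 1) / s)"
    using s by (simp add: field_simps power2_eq_square)
  also have "\<dots> \<le> (s - 1) * (s - 2) * a t + C * 1"
    using s \<open>C \<ge> 0\<close> by (intro add_left_mono mult_left_mono) auto
  finally show ?case using Suc by (simp add: s_def algebra_simps)
qed simp

text \<open>\<open>A\<close> measures the initial value in units of \<open>C / E\<^sup>2\<close>.
  The delay \<open>T\<close> is the least nonnegative shift with \<open>T + E \<ge> A\<close>, so
  the initial term costs at most \<open>(T + E) * C\<close>.\<close>

lemma shifted_recursion_rate:
  fixes a :: "nat \<Rightarrow> real"
  assumes "E \<ge> 4" "C \<ge> 0" "A \<ge> 0"
    and step: "\<And>t. a (Suc t) \<le> (1 - 2 / (real t + E)) * a t + C / (real t + E)\<^sup>2"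
    and a0: "a 0 = A * C / E\<^sup>2" and T: "T = max A E - E" "real t \<ge> T"
  shows "a t \<le> 4 * C / (real t - T + E)"
proof -
  define s where "s = real t + E"
  have s: "s \<ge> 4" "s - T \<ge> 4" "T \<ge> 0" using assms by (auto simp: s_def)
  have "(E - 1) * (E - 2) * a 0 \<le> E\<^sup>2 * a 0"
    using assms by (intro mult_right_mono) (auto simp: power2_eq_square intro!: mult_mono)
  also have "\<dots> = A * C" using assms by (simp add: a0)
  also have "\<dots> \<le> (T + E) * C" using assms by (intro mult_right_mono) auto
  \<comment> \<open>The initial term and the accumulated \<open>C * real t\<close> combine to
    \<open>(s + T) * C\<close>, since \<open>s = real t + E\<close>.\<close>
  finally have "(s - 1) * (s - 2) * a t \<le> (s + T) * C"
    using shifted_recursion_bound[OF assms(1,2) step, of t] by (simp add: s_def algebra_simps)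
  then have "(s - 1) * (s - 2) * (a t * (s - T)) \<le> (s + T) * C * (s - T)"
    using s by (metis mult.assoc mult_right_mono order_trans[of 0 4] zero_le_numeral)
  also have "\<dots> = C * (s\<^sup>2 - T\<^sup>2)" by (simp add: algebra_simps power2_eq_square)
  also have "\<dots> \<le> C * (4 * ((s - 1) * (s - 2)))"
  proof (intro mult_left_mono)
    \<comment> \<open>The right-hand side is exactly
      \<open>4 * (s - 1) * (s - 2) - (s\<^sup>2 - T\<^sup>2)\<close>.\<close>
    have "0 \<le> 3 * s * (s - 4) + 8 + T\<^sup>2" using s by simp
    then show "s\<^sup>2 - T\<^sup>2 \<le> 4 * ((s - 1) * (s - 2))" by (simp add: algebra_simps power2_eq_square)
  qed fact
  also have "\<dots> = (s - 1) * (s - 2) * (4 * C)" by simp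
  finally have "a t * (s - T) \<le> 4 * C"
    using s by (subst (asm) mult_le_cancel_left_pos) auto
  then show ?thesis
    using s by (simp add: s_def field_simps)
qed

theorem theorem2:
  fixes M :: "'o measure" and S :: "'x measure"
    and \<xi> :: "'o \<Rightarrow> 'x" and \<Xi> :: "nat \<Rightarrow> 'o \<Rightarrow> 'x"
    and f :: "real ^ 'd \<Rightarrow> 'x \<Rightarrow> real" and F :: "real ^ 'd \<Rightarrow> real"
    and w0 wstar :: "real ^ 'd" and \<eta> :: "nat \<Rightarrow> real"
    and \<mu> L N \<alpha> E T :: real and t :: nat
  assumes "prob_space M"
    and "\<xi> \<in> measurable M S"
    and "prob_space.indep_vars M (\<lambda>_. S) \<Xi> UNIV"
    and "\<And>s. distr M S (\<Xi> s) = distr M S \<xi>"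
    and "\<And>w. f w \<in> borel_measurable S"
    and "\<And>w. integrable M (\<lambda>\<omega>. f w (\<xi> \<omega>))"
    and "F = (\<lambda>w. \<integral>\<omega>. f w (\<xi> \<omega>) \<partial>M)"
    and "\<And>x w. x \<in> space S \<Longrightarrow> (\<lambda>v. f v x) differentiable (at w)"
    and "\<And>w. F differentiable (at w)"
    and "\<And>w. has_bochner_integral M (\<lambda>\<omega>. grad (\<lambda>v. f v (\<xi> \<omega>)) w) (grad F w)"
    and "\<mu> > 0" and "strongly_convex \<mu> F"
    and "L > 0" and "\<And>x. x \<in> space S \<Longrightarrow> smooth L (\<lambda>w. f w x)"
    and "\<And>x. x \<in> space S \<Longrightarrow> first_order_convex (\<lambda>w. f w x)"
    and "is_arg_min F (\<lambda>_. True) wstar"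
    and "integrable M (\<lambda>\<omega>. (norm (grad (\<lambda>w. f w (\<xi> \<omega>)) wstar))\<^sup>2)"
    and "N = 2 * (\<integral>\<omega>. (norm (grad (\<lambda>w. f w (\<xi> \<omega>)) wstar))\<^sup>2 \<partial>M)"
    and "N > 0"
    and "\<alpha> = 2" and "E = 2 * \<alpha> * L / \<mu>"
    and "\<eta> = (\<lambda>s. \<alpha> / (\<mu> * (real s + E)))"
    and "T = 4 * L / \<mu> * max (L * \<mu> / N * (norm (w0 - wstar))\<^sup>2) 1 - 4 * L / \<mu>"
    and "real t \<ge> T"
  shows "integrable M (\<lambda>\<omega>. (norm (sgd f \<eta> w0 (\<lambda>s. \<Xi> s \<omega>) t - wstar))\<^sup>2) \<and>
         (\<integral>\<omega>. (norm (sgd f \<eta> w0 (\<lambda>s. \<Xi> s \<omega>) t - wstar))\<^sup>2 \<partial>M)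
           \<le> 4 * \<alpha>\<^sup>2 * N / \<mu>\<^sup>2 * (1 / (real t - T + E))"
proof -
  note \<xi> = assms(2)
  \<comment> \<open>Both locales work with the law of a sample on the sample space itself;
    expectations over \<xi> are transported to \<open>P\<close> by the change of variables for
    \<open>distr\<close>.\<close>
  define P where "P = distr M S \<xi>"
  have [simp]: "space P = space S" and [measurable_cong, simp]: "sets P = sets S"
    by (simp_all add: P_def)
  have meas_grad: "(\<lambda>x. grad (\<lambda>v. f v x) w) \<in> borel_measurable S" for w
    using assms(5,8) by (rule borel_measurable_grad)
  have meas_sq: "(\<lambda>x. (norm (grad (\<lambda>v. f v x) w))\<^sup>2) \<in> borel_measurable S" for w
    using meas_grad by measurable
  interpret M: prob_space M by fact
  interpret P: prob_space P unfolding P_def by (rule M.prob_space_distr[OF \<xi>])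
  have E: "E = 4 * L / \<mu>" using assms(20,21) by simp
  have E_pos: "E > 0" using assms(11,13) by (simp add: E)
  have eta: "\<eta> s = 2 / (\<mu> * (real s + E))" for s using assms(20,22) by simp
  interpret sgd_process P f F \<mu> L wstar M \<Xi> \<eta> w0
  proof
    show "f w \<in> borel_measurable P" for w using assms(5) by simp
    show "integrable P (f w)" for w
      unfolding P_def using assms(5,6) by (subst integrable_distr_eq[OF \<xi>]) auto
    show "F w = (\<integral>x. f w x \<partial>P)" for w
      unfolding P_def using assms(5,7) by (subst integral_distr[OF \<xi>]) auto
    show "has_bochner_integral P (\<lambda>x. grad (\<lambda>v. f v x) w) (grad F w)" for w
      using assms(10)[of w] meas_grad[of w] unfolding P_def
      by (simp add: has_bochner_integral_iff integrable_distr_eq[OF \<xi>] integral_distr[OF \<xi>])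
    show "integrable P (\<lambda>x. (norm (grad (\<lambda>w. f w x) wstar))\<^sup>2)"
      unfolding P_def using assms(17) meas_sq by (subst integrable_distr_eq[OF \<xi>]) auto
    show "F wstar \<le> F w" for w
      using assms(16) by (auto simp: is_arg_min_def not_less)
    show "M.indep_vars (\<lambda>_. P) \<Xi> UNIV"
      using assms(3) by (simp add: M.indep_vars_def2 cong: measurable_cong_sets)
    show "distr M P (\<Xi> s) = P" for s
      using assms(4)[of s] distr_cong[of M M P S "\<Xi> s" "\<Xi> s"] by (simp add: P_def)
    show "\<eta> s \<ge> 0" for s using E_pos assms(11) by (simp add: eta)
    show "2 * L * \<eta> s \<le> 1" for s
    proof -
      have "2 * L * \<eta> s = E / (real s + E)" by (simp add: eta E)
      then show ?thesis using E_pos by simp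
    qed
  qed (use assms in auto)
  have noise: "noise = N"
  proof -
    have "(\<integral>x. (norm (grad (\<lambda>w. f w x) wstar))\<^sup>2 \<partial>P) = (\<integral>\<omega>. (norm (grad (\<lambda>w. f w (\<xi> \<omega>)) wstar))\<^sup>2 \<partial>M)"
      unfolding P_def using meas_sq by (rule integral_distr[OF \<xi>])
    then show ?thesis by (simp add: noise_def assms(18))
  qed
  define a where "a s = (\<integral>\<omega>. (norm (w s \<omega> - wstar))\<^sup>2 \<partial>M)" for s
  define C where "C = 4 * N / \<mu>\<^sup>2"
  \<comment> \<open>\<open>A\<close> is \<open>E\<close> times the first argument of
    \<open>max\<close> in \<open>T\<close>, whence \<open>T = max A E - E\<close>. With
    \<open>E = 4 * L / \<mu>\<close> it also satisfies
    \<open>A * C / E\<^sup>2 = (norm (w0 - wstar))\<^sup>2\<close>, the initial value.\<close>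
  define A where "A = 4 * L\<^sup>2 / N * (norm (w0 - wstar))\<^sup>2"
  have "a t \<le> 4 * C / (real t - T + E)"
  proof (rule shifted_recursion_rate)
    show "E \<ge> 4" using mu_le_L assms(11) by (simp add: E field_simps)
    show "C \<ge> 0" "A \<ge> 0" using assms(19) by (auto simp: C_def A_def)
    show "a (Suc s) \<le> (1 - 2 / (real s + E)) * a s + C / (real s + E)\<^sup>2" for s
    proof -
      have "\<mu> * \<eta> s = 2 / (real s + E)" "(\<eta> s)\<^sup>2 * noise = C / (real s + E)\<^sup>2"
        using assms(11) by (simp_all add: eta C_def noise power_divide power_mult_distrib)
      then show ?thesis using integral_w_Suc_le[of s] by (simp add: a_def)
    qed
    show "a 0 = A * C / E\<^sup>2"
      using assms(11,13,19) by (simp add: a_def w_0 M.prob_space A_def C_def E field_simps power2_eq_square)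
    have "4 * L / \<mu> * (L * \<mu> / N * (norm (w0 - wstar))\<^sup>2) = A"
      using assms(11) by (simp add: A_def power2_eq_square)
    then show "T = max A E - E"
      using assms(11,13) by (simp add: assms(23) E max_mult_distrib_left)
  qed fact
  then show ?thesis
    using integrable_w[of t] by (simp add: a_def w_def C_def assms(20))
qed

end
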